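(* Let $k\ge 3$ be an integer, let $N_1,\dots,N_k$ be positive integers, and let $F(i_1,\dots,i_k)$ be an arbitrary complex-valued function of integers $i_1,\dots,i_k$ with $1\le i_r\le N_r$ for $1\le r\le k$. Then the map $$(i_1,\dots,i_k)\mapsto q=i_1+N_1(i_2-1)+N_1N_2(i_3-1)+\cdots+\Big[\prod_{j=1}^{k-1}N_j\Big](i_k-1)$$ is a one-to-one correspondence between the set of integer tuples $(i_1,\dots,i_k)$ with $1\le i_r\le N_r$ for all $r$ and the set $\{1,\dots,\prod_{j=1}^{k}N_j\}$, its inverse is given by $$i_r=i_r(q)=1+\left\lfloor N_r\left\{\frac{q-1}{\prod_{j=1}^{r}N_j}\right\}\right\rfloor,\qquad 1\le r\le k,$$ and consequently $$\sum_{i_1=1}^{N_1}\sum_{i_2=1}^{N_2}\cdots\sum_{i_k=1}^{N_k}F(i_1,i_2,\dots,i_k)=\sum_{q=1}^{N_1N_2\cdots N_k}F\big(i_1(q),\dots,i_k(q)\big).$$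
   Context: $\lfloor x\rfloor=\max\{m\in\mathbb{Z}: m\le x\}$ is the floor function and $\{x\}=x-\lfloor x\rfloor$ is the fractional part of a real number $x$ (inside the formula for $i_r$, curly braces denote the fractional part). *)

theory Defs
  imports Complex_Main "HOL-Library.FuncSet"
begin

text \<open>
  A tuple \<open>(i\<^sub>1, \<dots>, i\<^sub>k)\<close> is an extensional function on the index set
  \<open>{1..k}\<close>: it takes the value \<open>undefined\<close> off \<open>{1..k}\<close>, so
  that equality of functions is equality of tuples.
\<close>

definition tuples :: "nat \<Rightarrow> (nat \<Rightarrow> int) \<Rightarrow> (nat \<Rightarrow> int) set" where
  "tuples k N = (\<Pi>\<^sub>E r\<in>{1..k}. {1..N r})"

definition position :: "nat \<Rightarrow> (nat \<Rightarrow> int) \<Rightarrow> (nat \<Rightarrow> int) \<Rightarrow> int" where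
  "position k N i = i 1 + (\<Sum>r=2..k. (\<Prod>j=1..r-1. N j) * (i r - 1))"

definition index_tuple :: "nat \<Rightarrow> (nat \<Rightarrow> int) \<Rightarrow> int \<Rightarrow> nat \<Rightarrow> int" where
  "index_tuple k N q =
     (\<lambda>r\<in>{1..k}. 1 + \<lfloor>real_of_int (N r) * frac (real_of_int (q - 1) / real_of_int (\<Prod>j=1..r. N j))\<rfloor>)"

text \<open>
  The iterated sum with \<open>i\<^sub>1\<close> as outermost and \<open>i\<^sub>k\<close> as
  innermost summation variable; the recursion splits off the innermost sum.
\<close>

primrec iterated_sum ::
  "nat \<Rightarrow> (nat \<Rightarrow> int) \<Rightarrow> ((nat \<Rightarrow> int) \<Rightarrow> complex) \<Rightarrow> complex" where
  "iterated_sum 0 N F = F (\<lambda>_. undefined)"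
| "iterated_sum (Suc k) N F =
     iterated_sum k N (\<lambda>i. \<Sum>m=1..N (Suc k). F (i(Suc k := m)))"

end

(* Write P r = N 1 * ... * N r. Up to the shift by 1, index_tuple reads off the digits
   x mod P r div P (r - 1) of x = q - 1 in the mixed radix system with bases N 1, ..., N k, and
   position reassembles a number from its digits, because the partial sums telescope to x mod P r.
   So index_tuple is injective on {1..P k}. Since there are P k tuples, it is a bijection, and
   position is its inverse. *)
theory Submission imports Defs begin

text \<open>Dividing with remainder, the fractional part of \<open>x / (m * n)\<close> is
  \<open>(x mod (m * n)) / (m * n)\<close>. The factor \<open>n\<close> cancels, and the floor of
  the remaining quotient by \<open>m\<close> is integer division.\<close>

lemma floor_mult_frac_divide:
  fixes x m n :: int
  assumes "m > 0" "n > 0"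
  shows "\<lfloor>real_of_int n * frac (real_of_int x / real_of_int (m * n))\<rfloor> = x mod (m * n) div m"
proof -
  have "frac (real_of_int x / real_of_int (m * n))
      = real_of_int x / real_of_int (m * n) - real_of_int (x div (m * n))"
    by (simp only: frac_def floor_divide_of_int_eq)
  also have "\<dots> = real_of_int (x - m * n * (x div (m * n))) / real_of_int (m * n)"
    using assms by (simp add: field_simps)
  also have "x - m * n * (x div (m * n)) = x mod (m * n)"
    by (simp add: minus_mult_div_eq_mod)
  finally have "real_of_int n * frac (real_of_int x / real_of_int (m * n))
      = real_of_int (x mod (m * n)) / real_of_int m"
    using assms by (simp add: field_simps)
  then show ?thesis
    by (simp only: floor_divide_of_int_eq)
qed

lemma prod_split_last:
  fixes N :: "nat \<Rightarrow> 'a::comm_monoid_mult"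
  assumes "r \<ge> 1"
  shows "(\<Prod>j=1..r. N j) = (\<Prod>j=1..r-1. N j) * N r"
  using assms by (cases r) simp_all

lemma prod_pos_upto:
  fixes N :: "nat \<Rightarrow> int"
  assumes "\<forall>r\<in>{1..k}. N r > 0" "r \<le> k"
  shows "(\<Prod>j=1..r. N j) > 0"
  using assms by (intro prod_pos) auto

lemma index_tuple_eq_digit:
  assumes "\<forall>r\<in>{1..k}. N r > 0" "r \<in> {1..k}"
  shows "index_tuple k N q r = 1 + (q - 1) mod (\<Prod>j=1..r. N j) div (\<Prod>j=1..r-1. N j)"
proof -
  have "(\<Prod>j=1..r-1. N j) > 0"
    using assms by (intro prod_pos_upto[of k]) auto
  moreover have "N r > 0"
    using assms by blast
  moreover have "(\<Prod>j=1..r. N j) = (\<Prod>j=1..r-1. N j) * N r"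
    using assms by (intro prod_split_last) auto
  ultimately show ?thesis
    using assms(2) floor_mult_frac_divide[of "\<Prod>j=1..r-1. N j" "N r" "q - 1"]
    \<comment> \<open>The casts must stay outside the products and the difference for the instance
      above to match.\<close>
    by (simp add: index_tuple_def del: of_int_mult of_int_prod of_int_diff)
qed

lemma index_tuple_in_tuples:
  assumes "\<forall>r\<in>{1..k}. N r > 0"
  shows "index_tuple k N q \<in> tuples k N"
  unfolding tuples_def
proof (rule PiE_I)
  fix r assume r: "r \<in> {1..k}"
  let ?m = "\<Prod>j=1..r-1. N j" and ?x = "(q - 1) mod (\<Prod>j=1..r. N j)"
  have m: "?m > 0"
    using r by (intro prod_pos_upto[OF assms]) auto
  have P: "(\<Prod>j=1..r. N j) > 0"
    using r by (intro prod_pos_upto[OF assms]) auto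
  have split: "(\<Prod>j=1..r. N j) = ?m * N r"
    using r by (intro prod_split_last) auto
  have "0 \<le> ?x div ?m"
    using m P by (intro pos_imp_zdiv_nonneg_iff[THEN iffD2] pos_mod_sign)
  moreover have "?x < ?m * N r"
    using pos_mod_bound[OF P] split by metis
  \<comment> \<open>Since \<open>?m * (?x div ?m)\<close> is at most \<open>?x\<close>, it is below
    \<open>?m * N r\<close>, and the positive factor \<open>?m\<close> cancels.\<close>
  then have "?x div ?m < N r"
    using m by (smt (verit) mult_left_less_imp_less mult_div_mod_eq pos_mod_sign)
  ultimately show "index_tuple k N q r \<in> {1..N r}"
    unfolding index_tuple_eq_digit[OF assms r] by auto
next
  fix r assume "r \<notin> {1..k}"
  then show "index_tuple k N q r = undefined"
    by (auto simp: index_tuple_def)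
qed

text \<open>The sum telescopes: its summand at \<open>r\<close> is the residue of \<open>x\<close>
  modulo the product of the first \<open>r\<close> bases minus the residue modulo the product of the
  first \<open>r - 1\<close>. The start is \<open>x mod 1 = 0\<close>, from the empty
  product.\<close>

lemma sum_digits_eq_mod:
  fixes N :: "nat \<Rightarrow> int"
  shows "(\<Sum>r=1..k. (\<Prod>j=1..r-1. N j) * (x mod (\<Prod>j=1..r. N j) div (\<Prod>j=1..r-1. N j)))
    = x mod (\<Prod>j=1..k. N j)"
proof (induction k)
  case (Suc k)
  let ?m = "\<Prod>j=1..k. N j"
  \<comment> \<open>Division of \<open>x mod (?m * N (Suc k))\<close> by \<open>?m\<close> leaves
    the remainder \<open>x mod ?m\<close>, as \<open>?m\<close> divides the larger modulus.\<close>
  have "x mod ?m + ?m * (x mod (?m * N (Suc k)) div ?m) = x mod (?m * N (Suc k))"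
    using mod_mult_div_eq[of "x mod (?m * N (Suc k))" ?m]
    by (simp add: mod_mod_cancel)
  with Suc show ?case
    by simp
qed simp

text \<open>The leading \<open>i 1\<close> is \<open>1 + (i 1 - 1)\<close>, where the weight of
  \<open>i 1 - 1\<close> is an empty product. This brings \<open>position\<close> into the form of
  the digit sum.\<close>

lemma position_eq_sum:
  assumes "k \<ge> 1"
  shows "position k N i = 1 + (\<Sum>r=1..k. (\<Prod>j=1..r-1. N j) * (i r - 1))"
proof -
  have "{1..k} = insert 1 {2..k}"
    using assms by auto
  then show ?thesis
    by (simp add: position_def)
qed

lemma position_index_tuple:
  assumes "k \<ge> 1" "\<forall>r\<in>{1..k}. N r > 0" "q \<in> {1..\<Prod>j=1..k. N j}"
  shows "position k N (index_tuple k N q) = q"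
proof -
  have "position k N (index_tuple k N q) = 1 + (q - 1) mod (\<Prod>j=1..k. N j)"
    unfolding position_eq_sum[OF assms(1)]
    by (subst sum_digits_eq_mod[where x = "q - 1", symmetric], rule arg_cong[where f = "(+) 1"])
       (intro sum.cong refl, simp add: index_tuple_eq_digit[OF assms(2)] del: One_nat_def)
  \<comment> \<open>Here \<open>q - 1\<close> is nonnegative and smaller than the modulus, so it is
    its own residue.\<close>
  also have "\<dots> = q"
    using assms(3) by simp
  finally show ?thesis .
qed

lemma card_tuples:
  assumes "\<forall>r\<in>{1..k}. N r > 0"
  shows "card (tuples k N) = nat (\<Prod>j=1..k. N j)"
proof -
  have "int (card (tuples k N)) = (\<Prod>j=1..k. N j)"
    \<comment> \<open>Each factor is \<open>nat (N r)\<close>; positivity turns it back into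
      \<open>N r\<close>.\<close>
    using assms by (simp add: tuples_def card_PiE less_imp_le)
  then show ?thesis
    by linarith
qed

lemma bij_betw_index_tuple:
  assumes "k \<ge> 1" "\<forall>r\<in>{1..k}. N r > 0"
  shows "bij_betw (index_tuple k N) {1..\<Prod>j=1..k. N j} (tuples k N)"
proof -
  let ?Q = "{1..\<Prod>j=1..k. N j}"
  have inj: "inj_on (index_tuple k N) ?Q"
    by (rule inj_on_inverseI[of _ "position k N"]) (rule position_index_tuple[OF assms])
  have "index_tuple k N ` ?Q = tuples k N"
  proof (rule card_subset_eq)
    show "finite (tuples k N)"
      by (simp add: tuples_def finite_PiE)
    show "index_tuple k N ` ?Q \<subseteq> tuples k N"
      using index_tuple_in_tuples[OF assms(2)] by blast
    show "card (index_tuple k N ` ?Q) = card (tuples k N)"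
      by (simp only: card_image[OF inj] card_tuples[OF assms(2)] card_atLeastAtMost_int add_diff_cancel_right')
  qed
  with inj show ?thesis
    by (simp add: bij_betw_def)
qed

text \<open>A longer tuple arises from exactly one shorter tuple and one last entry: all shorter
  tuples are \<open>undefined\<close> at \<open>Suc k\<close>, so the update loses no
  information.\<close>

lemma sum_tuples_Suc:
  "sum F (tuples (Suc k) N) = (\<Sum>i\<in>tuples k N. \<Sum>m=1..N (Suc k). F (i(Suc k := m)))"
proof -
  have "tuples (Suc k) N = (\<lambda>(m, i). i(Suc k := m)) ` ({1..N (Suc k)} \<times> tuples k N)"
    by (simp add: tuples_def atLeastAtMostSuc_conv PiE_insert_eq)
  moreover have "inj_on (\<lambda>(m, i). i(Suc k := m)) ({1..N (Suc k)} \<times> tuples k N)"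
    unfolding tuples_def by (rule inj_combinator) simp
  ultimately have "sum F (tuples (Suc k) N)
      = (\<Sum>(m, i)\<in>{1..N (Suc k)} \<times> tuples k N. F (i(Suc k := m)))"
    by (simp add: sum.reindex case_prod_unfold)
  also have "\<dots> = (\<Sum>m=1..N (Suc k). \<Sum>i\<in>tuples k N. F (i(Suc k := m)))"
    by (simp add: sum.cartesian_product)
  finally show ?thesis
    \<comment> \<open>The swap makes the last coordinate the innermost variable, as in the recursion
      of \<open>iterated_sum\<close>.\<close>
    by (simp add: sum.swap[of _ "tuples k N"])
qed

lemma iterated_sum_eq_sum_tuples: "iterated_sum k N F = sum F (tuples k N)"
\<comment> \<open>The recursion replaces the summand by an inner sum, so \<open>F\<close> has to
  vary. For \<open>k = 0\<close> the only tuple is the everywhere \<open>undefined\<close>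
  function.\<close>
proof (induction k arbitrary: F)
  case 0
  then show ?case
    by (simp add: tuples_def)
next
  case (Suc k)
  then show ?case
    by (simp add: sum_tuples_Suc)
qed

theorem mainTheorem3:
  fixes k :: nat and N :: "nat \<Rightarrow> int" and F :: "(nat \<Rightarrow> int) \<Rightarrow> complex"
  assumes "k \<ge> 3"
    and "\<forall>r\<in>{1..k}. N r > 0"
  shows "bij_betw (position k N) (tuples k N) {1..\<Prod>j=1..k. N j}
    \<and> (\<forall>q\<in>{1..\<Prod>j=1..k. N j}.
          inv_into (tuples k N) (position k N) q = index_tuple k N q)
    \<and> iterated_sum k N F = (\<Sum>q=1..(\<Prod>j=1..k. N j). F (index_tuple k N q))"
proof -
  let ?Q = "{1..\<Prod>j=1..k. N j}"
  have k: "k \<ge> 1"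
    using assms(1) by simp
  note bij = bij_betw_index_tuple[OF k assms(2)]
  note left_inverse = position_index_tuple[OF k assms(2)]
  \<comment> \<open>With every tuple written as \<open>index_tuple k N q\<close>, the one-sided
    identity \<open>left_inverse\<close> yields both inverse laws.\<close>
  have tuples: "tuples k N = index_tuple k N ` ?Q"
    using bij by (simp add: bij_betw_def)
  have pos: "bij_betw (position k N) (tuples k N) ?Q"
    using left_inverse unfolding tuples
    by (intro bij_betw_byWitness[where f' = "index_tuple k N"]) auto
  moreover have "inv_into (tuples k N) (position k N) q = index_tuple k N q" if "q \<in> ?Q" for q
    using pos left_inverse[OF that] index_tuple_in_tuples[OF assms(2)]
    by (intro inv_into_f_eq) (auto simp: bij_betw_def)
  moreover have "iterated_sum k N F = (\<Sum>q\<in>?Q. F (index_tuple k N q))"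
    by (simp only: iterated_sum_eq_sum_tuples sum.reindex_bij_betw[OF bij, of F])
  ultimately show ?thesis
    by blast
qed

end
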